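(* Let $\theta$ and $\tau$ be cyclic permutations of order $6$ in $S_6$, viewed as permutations of $\{1,2\}\times\{1,2,3\}$, that lie in different product conjugacy classes. Then $\theta$ and $\tau$ are not product unitarily equivalent.
   Context: Permutations $\theta,\tau$ of $\{1,2\}\times\{1,2,3\}$ are product conjugate if $\theta=\sigma\tau\sigma^{-1}$ for some $\sigma$ in the subgroup $S_2\times S_3$ (acting coordinatewise). For such a permutation $\theta$, $\pi(\theta)$ is the permutation unitary on $\mathbb C^2\otimes\mathbb C^3$ with $\pi(\theta)e_{ij}=e_{\theta(i,j)}$, where $e_{ij}=e_i\otimes e_j$. $\theta$ and $\tau$ are product unitarily equivalent if there are unitary matrices $A\in M_2(\mathbb C)$, $B\in M_3(\mathbb C)$ with $\pi(\tau)(A\otimes B)=(A\otimes B)\pi(\theta)$. *)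

theory Defs
  imports "HOL-Analysis.Analysis" "HOL-Combinatorics.Cycles"
begin

text \<open>
  The set \<open>{1,2} \<times> {1,2,3}\<close> is the type \<^typ>\<open>2 \<times> 3\<close> of pairs of numeral types. The definitions
  are made for \<^typ>\<open>'m \<times> 'n\<close> with arbitrary finite index types. Matrices act on column vectors,
  \<open>M $ p $ q\<close> being the entry in row \<open>p\<close> and column \<open>q\<close>.
\<close>

definition is_cycle_of_length :: "nat \<Rightarrow> ('a \<Rightarrow> 'a) \<Rightarrow> bool" where
  "is_cycle_of_length k \<theta> \<longleftrightarrow> (\<exists>cs. cycle cs \<and> length cs = k \<and> \<theta> = cycle_of_list cs)"

definition product_conjugate ::
    "('m::finite \<times> 'n::finite \<Rightarrow> 'm \<times> 'n) \<Rightarrow> ('m \<times> 'n \<Rightarrow> 'm \<times> 'n) \<Rightarrow> bool" where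
  "product_conjugate \<theta> \<tau> \<longleftrightarrow>
     (\<exists>\<alpha> \<beta>. \<alpha> permutes UNIV \<and> \<beta> permutes UNIV \<and>
        \<theta> = map_prod \<alpha> \<beta> \<circ> \<tau> \<circ> inv (map_prod \<alpha> \<beta>))"

definition conj_transpose :: "complex^'n^'m \<Rightarrow> complex^'m^'n" where
  "conj_transpose A = (\<chi> i j. cnj (A $ j $ i))"

definition unitary_matrix :: "complex^'n^'n \<Rightarrow> bool" where
  "unitary_matrix A \<longleftrightarrow> conj_transpose A ** A = mat 1 \<and> A ** conj_transpose A = mat 1"

definition tensor_vec :: "complex^'m \<Rightarrow> complex^'n \<Rightarrow> complex^('m::finite \<times> 'n::finite)" where
  "tensor_vec u v = (\<chi> p. u $ fst p * v $ snd p)"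

definition tensor_matrix ::
    "complex^'m^'m \<Rightarrow> complex^'n^'n \<Rightarrow> complex^('m::finite \<times> 'n::finite)^('m \<times> 'n)" where
  "tensor_matrix A B = (\<chi> p q. A $ fst p $ fst q * B $ snd p $ snd q)"

lemma tensor_matrix_mult_tensor_vec:
  "tensor_matrix A B *v tensor_vec u v = tensor_vec (A *v u) (B *v v)"
  unfolding vec_eq_iff
  by (auto simp: tensor_matrix_def tensor_vec_def matrix_vector_mult_def sum_product
        sum.cartesian_product case_prod_beta mult_ac UNIV_Times_UNIV[symmetric]
        simp del: UNIV_Times_UNIV intro!: sum.cong)

text \<open>Column \<open>q\<close> is the basis vector with index \<open>\<theta> q\<close>; see \<open>perm_matrix_tensor_vec_axis\<close>.\<close>

definition perm_matrix :: "('a \<Rightarrow> 'a) \<Rightarrow> complex^('a::finite)^'a" where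
  "perm_matrix \<theta> = (\<chi> p q. if p = \<theta> q then 1 else 0)"

lemma perm_matrix_axis: "perm_matrix \<theta> *v axis q 1 = axis (\<theta> q) 1"
  by (simp add: vec_eq_iff matrix_vector_mult_def perm_matrix_def axis_def
        if_distrib[where f = "(*) _"] cong: if_cong)

lemma tensor_vec_axis: "tensor_vec (axis i 1) (axis j 1) = axis (i, j) 1"
  by (auto simp: vec_eq_iff tensor_vec_def axis_def)

lemma perm_matrix_tensor_vec_axis:
  "perm_matrix \<theta> *v tensor_vec (axis i 1) (axis j 1) =
     tensor_vec (axis (fst (\<theta> (i, j))) 1) (axis (snd (\<theta> (i, j))) 1)"
  by (simp add: tensor_vec_axis perm_matrix_axis)

definition product_unitarily_equivalent ::
    "('m::finite \<times> 'n::finite \<Rightarrow> 'm \<times> 'n) \<Rightarrow> ('m \<times> 'n \<Rightarrow> 'm \<times> 'n) \<Rightarrow> bool" where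
  "product_unitarily_equivalent \<theta> \<tau> \<longleftrightarrow>
     (\<exists>(A :: complex^'m^'m) (B :: complex^'n^'n). unitary_matrix A \<and> unitary_matrix B \<and>
        perm_matrix \<tau> ** tensor_matrix A B = tensor_matrix A B ** perm_matrix \<theta>)"

end

theory Submission
  imports Defs "HOL-Combinatorics.Multiset_Permutations"
begin

text \<open>
  Write \<open>X\<^sub>k\<close> and \<open>Y\<^sub>k\<close> for the partial traces of \<open>\<pi>(\<theta>)\<^sup>k\<close> over the second and over the first
  tensor factor; they act on \<open>\<complex>\<^sup>2\<close> and on \<open>\<complex>\<^sup>3\<close>. If \<open>A \<otimes> B\<close> intertwines \<open>\<pi>(\<theta>)\<close> with \<open>\<pi>(\<tau>)\<close>, it
  intertwines their powers, and since a partial trace absorbs conjugation of the factor that is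
  traced out, \<open>A\<close> conjugates each \<open>X\<^sub>k\<close> of \<open>\<theta>\<close> into that of \<open>\<tau>\<close>, and \<open>B\<close> does the same for
  \<open>Y\<^sub>k\<close> (\<open>partial_trace_intertwines\<close>). So the trace of every word in the \<open>X\<^sub>k\<close>, and in the
  \<open>Y\<^sub>k\<close>, is the same for \<open>\<theta>\<close> and \<open>\<tau>\<close>. These traces are nonnegative integers that count
  configurations in the \<open>2 \<times> 3\<close> grid (\<open>closed_pairs\<close>, \<open>closed_triples\<close>).

  The 120 cycles of length 6 fall into 14 product conjugacy classes, and the three numbers
  \<open>tr(X\<^sub>1X\<^sub>5)\<close>, \<open>tr(Y\<^sub>1Y\<^sub>5)\<close>, \<open>tr(Y\<^sub>1Y\<^sub>2Y\<^sub>5)\<close> take 14 different values on them. The first two are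
  the squared Hilbert-Schmidt norms of \<open>X\<^sub>1\<close> and \<open>Y\<^sub>1\<close>, as \<open>\<pi>(\<theta>)\<^sup>5\<close> is the adjoint of \<open>\<pi>(\<theta>)\<close>.
  Cycles that are product unitarily equivalent have equal traces and so lie in the same class.

  To make the classification finite and explicit, a cycle is read as the word
  \<open>p, \<theta> p, \<dots>, \<theta>\<^sup>5 p\<close> of grid points. Only two things about this word matter, both for the
  invariants and for the conjugacy class: which of its letters share a row and which share a column
  (\<open>same_pattern\<close>). A choice of \<open>p\<close> rotates the word, and up to rotation there are 14 such
  patterns (\<open>representatives_exhaust\<close>).
\<close>

section \<open>Partial traces of intertwined operators\<close>

text \<open>
  An operator on the tensor product is a matrix of operators on the first factor, indexed by a basis
  of the second.
\<close>

definition block :: "complex^('m::finite \<times> 'n::finite)^('m \<times> 'n) \<Rightarrow> 'n \<Rightarrow> 'n \<Rightarrow> complex^'m^'m" where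
  "block Z j j' = (\<chi> i i'. Z $ (i, j) $ (i', j'))"

definition partial_trace :: "complex^('m::finite \<times> 'n::finite)^('m \<times> 'n) \<Rightarrow> complex^'n^'n" where
  "partial_trace Z = (\<chi> j j'. trace (block Z j j'))"

lemma sum_pairs: "(\<Sum>p\<in>UNIV. f p) = (\<Sum>i\<in>UNIV. \<Sum>j\<in>UNIV. f (i, j))"
  for f :: "'m::finite \<times> 'n::finite \<Rightarrow> 'c::comm_monoid_add"
  by (simp add: sum.cartesian_product case_prod_eta)

text \<open>
  Multiplication by \<open>A \<otimes> B\<close> on the left mixes the rows of blocks through \<open>B\<close> and multiplies each
  block by \<open>A\<close>. The free factor \<open>C\<close> will be the inverse of \<open>A\<close>: then \<open>A\<close> cancels here, while in
  the mirror image of this formula each block is conjugated by \<open>A\<close>, which its trace does not see.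
\<close>

lemma trace_block_tensor_mult:
  "trace (C ** block (tensor_matrix A B ** U) t j) =
     (\<Sum>l\<in>UNIV. B $ t $ l * trace (C ** A ** block U l j))"
proof -
  have "trace (C ** block (tensor_matrix A B ** U) t j) =
      (\<Sum>a\<in>UNIV. \<Sum>s\<in>UNIV. \<Sum>k\<in>UNIV. \<Sum>l\<in>UNIV. B $ t $ l * (C $ a $ s * A $ s $ k * U $ (k, l) $ (a, j)))"
    by (simp add: trace_def block_def matrix_matrix_mult_def tensor_matrix_def sum_pairs
        sum_distrib_left mult_ac)
  also have "\<dots> = (\<Sum>a\<in>UNIV. \<Sum>l\<in>UNIV. \<Sum>k\<in>UNIV. \<Sum>s\<in>UNIV. B $ t $ l * (C $ a $ s * A $ s $ k * U $ (k, l) $ (a, j)))"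
    by (subst (2) sum.swap, subst (3) sum.swap, subst (2) sum.swap) (rule refl)
  also have "\<dots> = (\<Sum>l\<in>UNIV. \<Sum>a\<in>UNIV. \<Sum>k\<in>UNIV. \<Sum>s\<in>UNIV. B $ t $ l * (C $ a $ s * A $ s $ k * U $ (k, l) $ (a, j)))"
    by (rule sum.swap)
  also have "\<dots> = (\<Sum>l\<in>UNIV. B $ t $ l * trace (C ** A ** block U l j))"
    by (simp add: trace_def block_def matrix_matrix_mult_def sum_distrib_left sum_distrib_right mult_ac)
  finally show ?thesis .
qed

lemma trace_block_mult_tensor:
  "trace (C ** block (V ** tensor_matrix A B) t j) =
     (\<Sum>l\<in>UNIV. trace (C ** block V t l ** A) * B $ l $ j)"
proof -
  have "trace (C ** block (V ** tensor_matrix A B) t j) =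
      (\<Sum>a\<in>UNIV. \<Sum>s\<in>UNIV. \<Sum>k\<in>UNIV. \<Sum>l\<in>UNIV. C $ a $ s * V $ (s, t) $ (k, l) * A $ k $ a * B $ l $ j)"
    by (simp add: trace_def block_def matrix_matrix_mult_def tensor_matrix_def sum_pairs
        sum_distrib_left mult_ac)
  also have "\<dots> = (\<Sum>a\<in>UNIV. \<Sum>l\<in>UNIV. \<Sum>k\<in>UNIV. \<Sum>s\<in>UNIV. C $ a $ s * V $ (s, t) $ (k, l) * A $ k $ a * B $ l $ j)"
    by (subst (2) sum.swap, subst (3) sum.swap, subst (2) sum.swap) (rule refl)
  also have "\<dots> = (\<Sum>l\<in>UNIV. \<Sum>a\<in>UNIV. \<Sum>k\<in>UNIV. \<Sum>s\<in>UNIV. C $ a $ s * V $ (s, t) $ (k, l) * A $ k $ a * B $ l $ j)"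
    by (rule sum.swap)
  also have "\<dots> = (\<Sum>l\<in>UNIV. trace (C ** block V t l ** A) * B $ l $ j)"
    by (simp add: trace_def block_def matrix_matrix_mult_def sum_distrib_left sum_distrib_right mult_ac)
  finally show ?thesis .
qed

text \<open>
  The two formulas above are applied to the two sides of the intertwining relation, with \<open>C\<close>
  inverse to \<open>A\<close>: what remains of \<open>A\<close> is a conjugation under the trace.
\<close>

lemma partial_trace_intertwines:
  assumes "invertible A" and "V ** tensor_matrix A B = tensor_matrix A B ** U"
  shows "partial_trace V ** B = B ** partial_trace U"
proof -
  obtain C where C: "A ** C = mat 1" "C ** A = mat 1"
    using assms(1) unfolding invertible_def by blast
  have cyc: "trace (C ** X ** A) = trace X" for X
    by (metis C(1) matrix_mul_assoc matrix_mul_rid trace_mul_sym)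
  have "(partial_trace V ** B) $ t $ j = (B ** partial_trace U) $ t $ j" for t j
  proof -
    have "(partial_trace V ** B) $ t $ j = trace (C ** block (V ** tensor_matrix A B) t j)"
      by (simp add: trace_block_mult_tensor cyc) (simp add: matrix_matrix_mult_def partial_trace_def)
    also have "\<dots> = (B ** partial_trace U) $ t $ j"
      unfolding assms(2)
      by (simp add: trace_block_tensor_mult C) (simp add: matrix_matrix_mult_def partial_trace_def)
    finally show ?thesis .
  qed
  then show ?thesis by (simp add: vec_eq_iff)
qed

lemma trace_eq_if_intertwined:
  fixes X Y B :: "complex^'n^'n"
  assumes "invertible B" and "Y ** B = B ** X"
  shows "trace Y = trace X"
  using assms unfolding invertible_def
  by (metis matrix_mul_assoc matrix_mul_lid matrix_mul_rid trace_mul_sym)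

lemma invertible_unitary_matrix: "unitary_matrix A \<Longrightarrow> invertible A"
  unfolding unitary_matrix_def invertible_def by blast

lemma perm_matrix_comp: "perm_matrix (f \<circ> g) = perm_matrix f ** perm_matrix g"
  by (simp add: vec_eq_iff matrix_matrix_mult_def perm_matrix_def
      if_distrib[where f = "(*) _"] cong: if_cong)

lemma perm_matrix_id: "perm_matrix id = mat 1"
  by (simp add: vec_eq_iff perm_matrix_def mat_def)

lemma intertwines_funpow:
  assumes "perm_matrix \<tau> ** M = M ** perm_matrix \<theta>"
  shows "perm_matrix (\<tau> ^^ k) ** M = M ** perm_matrix (\<theta> ^^ k)"
proof (induction k)
  case 0
  then show ?case by (simp add: perm_matrix_id flip: id_def)
next
  case (Suc k)
  have "perm_matrix (\<tau> ^^ Suc k) ** M = perm_matrix \<tau> ** (perm_matrix (\<tau> ^^ k) ** M)"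
    by (simp add: perm_matrix_comp matrix_mul_assoc)
  also have "\<dots> = perm_matrix \<tau> ** M ** perm_matrix (\<theta> ^^ k)"
    by (simp add: Suc matrix_mul_assoc)
  also have "\<dots> = M ** perm_matrix (\<theta> ^^ Suc k)"
    by (simp add: assms perm_matrix_comp matrix_mul_assoc)
  finally show ?case .
qed

section \<open>Traces of reduced powers as counts\<close>

lemma partial_trace_perm_matrix:
  "partial_trace (perm_matrix f) $ j $ j' =
     (\<Sum>p\<in>UNIV. of_bool (fst (f p) = fst p \<and> snd (f p) = j \<and> snd p = j'))"
proof -
  have "(\<Sum>l\<in>UNIV. of_bool (fst (f (i, l)) = i \<and> snd (f (i, l)) = j \<and> l = j')) =
      (\<Sum>l\<in>UNIV. if l = j' then of_bool (f (i, j') = (i, j)) else (0::complex))" for i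
    by (rule sum.cong) (auto simp: prod_eq_iff)
  then have "(\<Sum>p\<in>UNIV. of_bool (fst (f p) = fst p \<and> snd (f p) = j \<and> snd p = j')) =
      (\<Sum>i\<in>UNIV. of_bool (f (i, j') = (i, j)) :: complex)"
    by (simp add: sum_pairs del: sum_of_bool_eq)
  then show ?thesis
    by (auto simp: partial_trace_def trace_def block_def perm_matrix_def
        simp del: sum_of_bool_eq intro!: sum.cong)
qed

lemma partial_trace_perm_matrix_mult:
  "(partial_trace (perm_matrix f) ** Z) $ j $ j' =
     (\<Sum>p\<in>UNIV. of_bool (fst (f p) = fst p \<and> snd (f p) = j) * Z $ snd p $ j')"
proof -
  have "(partial_trace (perm_matrix f) ** Z) $ j $ j' =
      (\<Sum>p\<in>UNIV. \<Sum>l\<in>UNIV. if l = snd p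
         then of_bool (fst (f p) = fst p \<and> snd (f p) = j) * Z $ snd p $ j' else 0)"
    by (subst sum.swap)
      (auto simp: matrix_matrix_mult_def partial_trace_perm_matrix sum_distrib_right
        simp del: sum_of_bool_eq sum_mult_of_bool_eq sum_of_bool_mult_eq intro!: sum.cong)
  then show ?thesis by simp
qed

lemma trace_partial_trace_perm_matrix_mult:
  "trace (partial_trace (perm_matrix f) ** Z) =
     (\<Sum>p\<in>UNIV. of_bool (fst (f p) = fst p) * Z $ snd p $ snd (f p))"
proof -
  have "trace (partial_trace (perm_matrix f) ** Z) =
      (\<Sum>p\<in>UNIV. \<Sum>j\<in>UNIV. if j = snd (f p)
         then of_bool (fst (f p) = fst p) * Z $ snd p $ snd (f p) else 0)"
    unfolding trace_def partial_trace_perm_matrix_mult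
    by (subst sum.swap)
      (auto simp del: sum_of_bool_eq sum_mult_of_bool_eq sum_of_bool_mult_eq intro!: sum.cong)
  then show ?thesis by simp
qed

text \<open>
  The next two definitions count closed chains of moves. A move takes \<open>p\<close> to \<open>\<theta>\<^sup>k p\<close> without
  changing the first coordinate; a chain only remembers second coordinates, so that the next move
  may start anywhere in the column that the previous one has reached. The moves are composed like
  matrices, the last one first.
\<close>

definition closed_pairs :: "('m::finite \<times> 'n::finite \<Rightarrow> 'm \<times> 'n) \<Rightarrow> nat \<Rightarrow> nat \<Rightarrow> nat" where
  "closed_pairs \<theta> k l = (\<Sum>p\<in>UNIV. \<Sum>q\<in>UNIV. of_bool (
     fst ((\<theta> ^^ k) p) = fst p \<and> fst ((\<theta> ^^ l) q) = fst q \<and>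
     snd ((\<theta> ^^ l) q) = snd p \<and> snd q = snd ((\<theta> ^^ k) p)))"

definition closed_triples :: "('m::finite \<times> 'n::finite \<Rightarrow> 'm \<times> 'n) \<Rightarrow> nat \<Rightarrow> nat \<Rightarrow> nat \<Rightarrow> nat" where
  "closed_triples \<theta> k l m = (\<Sum>p\<in>UNIV. \<Sum>q\<in>UNIV. \<Sum>r\<in>UNIV. of_bool (
     fst ((\<theta> ^^ k) p) = fst p \<and> fst ((\<theta> ^^ l) q) = fst q \<and> fst ((\<theta> ^^ m) r) = fst r \<and>
     snd ((\<theta> ^^ l) q) = snd p \<and> snd ((\<theta> ^^ m) r) = snd q \<and> snd r = snd ((\<theta> ^^ k) p)))"

definition reduced_power :: "('m::finite \<times> 'n::finite \<Rightarrow> 'm \<times> 'n) \<Rightarrow> nat \<Rightarrow> complex^'n^'n" where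
  "reduced_power \<theta> k = partial_trace (perm_matrix (\<theta> ^^ k))"

lemma closed_pairs_eq_trace:
  "of_nat (closed_pairs \<theta> k l) = trace (reduced_power \<theta> k ** reduced_power \<theta> l)"
  unfolding closed_pairs_def reduced_power_def trace_partial_trace_perm_matrix_mult
    partial_trace_perm_matrix sum_distrib_left of_nat_sum
  by (simp add: of_bool_conj mult_ac del: sum_of_bool_eq sum_mult_of_bool_eq sum_of_bool_mult_eq)

lemma closed_triples_eq_trace:
  "of_nat (closed_triples \<theta> k l m) =
     trace (reduced_power \<theta> k ** (reduced_power \<theta> l ** reduced_power \<theta> m))"
  unfolding closed_triples_def reduced_power_def trace_partial_trace_perm_matrix_mult
    partial_trace_perm_matrix_mult partial_trace_perm_matrix sum_distrib_left of_nat_sum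
  by (simp add: of_bool_conj mult_ac del: sum_of_bool_eq sum_mult_of_bool_eq sum_of_bool_mult_eq)

text \<open>
  Words in the reduced powers of \<open>\<theta>\<close> and \<open>\<tau>\<close> are conjugate by \<open>B\<close>, so their traces agree.
\<close>

lemma closed_counts_eq_if_equivalent:
  assumes "product_unitarily_equivalent \<theta> \<tau>"
  shows "closed_pairs \<theta> k l = closed_pairs \<tau> k l"
    and "closed_triples \<theta> k l m = closed_triples \<tau> k l m"
proof -
  obtain A B where A: "invertible A" and B: "invertible B"
    and AB: "perm_matrix \<tau> ** tensor_matrix A B = tensor_matrix A B ** perm_matrix \<theta>"
    using assms unfolding product_unitarily_equivalent_def by (metis invertible_unitary_matrix)
  have intertwines: "reduced_power \<tau> k ** B = B ** reduced_power \<theta> k" for k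
    unfolding reduced_power_def
    by (rule partial_trace_intertwines[OF A intertwines_funpow[OF AB]])
  have intertwines_mult: "X' ** Y' ** B = B ** (X ** Y)"
    if "X' ** B = B ** X" "Y' ** B = B ** Y" for X X' Y Y'
    using that by (metis matrix_mul_assoc)
  have "trace (reduced_power \<tau> k ** reduced_power \<tau> l) =
      trace (reduced_power \<theta> k ** reduced_power \<theta> l)"
    by (intro trace_eq_if_intertwined[OF B] intertwines_mult intertwines)
  then show "closed_pairs \<theta> k l = closed_pairs \<tau> k l"
    by (simp flip: closed_pairs_eq_trace)
  have "trace (reduced_power \<tau> k ** (reduced_power \<tau> l ** reduced_power \<tau> m)) =
      trace (reduced_power \<theta> k ** (reduced_power \<theta> l ** reduced_power \<theta> m))"
    by (intro trace_eq_if_intertwined[OF B] intertwines_mult intertwines)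
  then show "closed_triples \<theta> k l m = closed_triples \<tau> k l m"
    by (simp flip: closed_triples_eq_trace)
qed

section \<open>Exchanging the tensor factors\<close>

text \<open>
  Conjugation by the flip turns partial traces over the first factor into partial traces over
  the second, so the counts of the flipped permutation are further invariants.
\<close>

definition swapped :: "('m \<times> 'n \<Rightarrow> 'm \<times> 'n) \<Rightarrow> 'n \<times> 'm \<Rightarrow> 'n \<times> 'm" where
  "swapped \<theta> = prod.swap \<circ> \<theta> \<circ> prod.swap"

lemma swapped_funpow: "(swapped \<theta> ^^ k) (prod.swap p) = prod.swap ((\<theta> ^^ k) p)"
  by (induction k) (simp_all add: swapped_def)

lemma product_unitarily_equivalent_swapped:
  fixes \<theta> \<tau> :: "'m::finite \<times> 'n::finite \<Rightarrow> 'm \<times> 'n"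
  assumes "product_unitarily_equivalent \<theta> \<tau>"
  shows "product_unitarily_equivalent (swapped \<theta>) (swapped \<tau>)"
proof -
  obtain A B where AB: "unitary_matrix A" "unitary_matrix B"
      "perm_matrix \<tau> ** tensor_matrix A B = tensor_matrix A B ** perm_matrix \<theta>"
    using assms unfolding product_unitarily_equivalent_def by blast
  have mult_swap: "(M ** N) $ prod.swap p $ prod.swap q =
      (\<Sum>r\<in>UNIV. M $ prod.swap p $ prod.swap r * N $ prod.swap r $ prod.swap q)"
    for M N :: "complex^('m \<times> 'n)^('m \<times> 'n)" and p q
    using sum.reindex_bij_betw[OF bij_swap, of "\<lambda>r. M $ prod.swap p $ r * N $ r $ prod.swap q"]
    by (simp add: matrix_matrix_mult_def)
  have tensor: "tensor_matrix B A $ p $ q = tensor_matrix A B $ prod.swap p $ prod.swap q" for p q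
    by (simp add: tensor_matrix_def)
  have perm: "perm_matrix (swapped \<theta>) $ p $ q = perm_matrix \<theta> $ prod.swap p $ prod.swap q"
    for \<theta> :: "'m \<times> 'n \<Rightarrow> 'm \<times> 'n" and p q
    by (cases p; cases "\<theta> (prod.swap q)") (auto simp: perm_matrix_def swapped_def)
  have "(perm_matrix (swapped \<tau>) ** tensor_matrix B A) $ p $ q =
      (tensor_matrix B A ** perm_matrix (swapped \<theta>)) $ p $ q" for p q
  proof -
    have "(perm_matrix (swapped \<tau>) ** tensor_matrix B A) $ p $ q =
        (perm_matrix \<tau> ** tensor_matrix A B) $ prod.swap p $ prod.swap q"
      unfolding mult_swap by (simp add: matrix_matrix_mult_def perm tensor)
    also have "\<dots> = (tensor_matrix B A ** perm_matrix (swapped \<theta>)) $ p $ q"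
      unfolding AB(3) mult_swap by (simp add: matrix_matrix_mult_def perm tensor)
    finally show ?thesis .
  qed
  then show ?thesis
    using AB unfolding product_unitarily_equivalent_def by (auto simp: vec_eq_iff)
qed


section \<open>Cycles as words\<close>

definition orbit :: "('a \<Rightarrow> 'a) \<Rightarrow> 'a \<Rightarrow> 'a list" where
  "orbit \<theta> p = map (\<lambda>x. (\<theta> ^^ x) p) [0..<6]"

definition full_orbit :: "('a \<Rightarrow> 'a) \<Rightarrow> 'a \<Rightarrow> bool" where
  "full_orbit \<theta> p \<longleftrightarrow> (\<theta> ^^ 6) p = p \<and> bij_betw (\<lambda>x. (\<theta> ^^ x) p) {..<6} UNIV"

lemma length_orbit [simp]: "length (orbit \<theta> p) = 6"
  by (simp add: orbit_def)

lemma nth_orbit: "x < 6 \<Longrightarrow> orbit \<theta> p ! x = (\<theta> ^^ x) p"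
  by (simp add: orbit_def)

lemma set_orbit: "full_orbit \<theta> p \<Longrightarrow> set (orbit \<theta> p) = UNIV"
  by (simp add: full_orbit_def orbit_def bij_betw_def lessThan_atLeast0)

lemma distinct_orbit: "full_orbit \<theta> p \<Longrightarrow> distinct (orbit \<theta> p)"
  by (simp add: full_orbit_def orbit_def bij_betw_def distinct_map lessThan_atLeast0)

lemma nth_orbit_mod: "full_orbit \<theta> p \<Longrightarrow> orbit \<theta> p ! (x mod 6) = (\<theta> ^^ x) p"
  by (simp add: full_orbit_def nth_orbit funpow_mod_eq)

lemma nth_orbit_add:
  "full_orbit \<theta> p \<Longrightarrow> orbit \<theta> p ! ((x + k) mod 6) = (\<theta> ^^ k) ((\<theta> ^^ x) p)"
  by (simp add: nth_orbit_mod add.commute[of x] funpow_add)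

lemma rotate_orbit:
  assumes "full_orbit \<theta> p"
  shows "rotate k (orbit \<theta> p) = orbit \<theta> ((\<theta> ^^ k) p)"
  by (rule nth_equalityI)
    (simp_all add: nth_rotate nth_orbit_mod[OF assms] nth_orbit funpow_add add.commute)

text \<open>
  The list that defines the cycle is itself the word of its head; the word of any other point is one
  of its rotations.
\<close>

lemma full_orbit_cycle:
  fixes \<theta> :: "'a::finite \<Rightarrow> 'a"
  assumes "is_cycle_of_length 6 \<theta>" and "CARD('a) = 6"
  shows "full_orbit \<theta> p"
proof -
  obtain cs where cs: "distinct cs" "length cs = 6" "\<theta> = cycle_of_list cs"
    using assms(1) unfolding is_cycle_of_length_def by blast
  then have "set cs = UNIV"
    using assms(2) by (metis card_subset_eq distinct_card finite subset_UNIV)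
  then obtain i where i: "i < 6" "p = cs ! i"
    using cs(2) by (metis UNIV_I in_set_conv_nth)
  have power: "(\<theta> ^^ x) p = cs ! ((x + i) mod 6)" for x
  proof -
    have "(\<theta> ^^ x) p = map (\<theta> ^^ x) cs ! i"
      using i cs(2) by simp
    then show ?thesis
      using cyclic_rotation[OF cs(1), of x] i cs by (simp add: nth_rotate)
  qed
  have "inj_on (\<lambda>x. (\<theta> ^^ x) p) {..<6}"
  proof (rule inj_onI)
    fix x y :: nat
    assume "x \<in> {..<6}" "y \<in> {..<6}" "(\<theta> ^^ x) p = (\<theta> ^^ y) p"
    then have "(x + i) mod 6 = (y + i) mod 6" and less: "x < 6" "y < 6"
      using cs(1,2) by (simp_all add: power nth_eq_iff_index_eq)
    then have "(x + i + (6 - i)) mod 6 = (y + i + (6 - i)) mod 6"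
      by (metis mod_add_left_eq)
    then show "x = y"
      using i(1) less by simp
  qed
  moreover from this have "(\<lambda>x. (\<theta> ^^ x) p) ` {..<6} = UNIV"
    using assms(2) by (intro card_subset_eq) (simp_all add: card_image)
  moreover have "(\<theta> ^^ 6) p = p"
    unfolding power using i by simp
  ultimately show ?thesis
    by (simp add: full_orbit_def bij_betw_def)
qed

lemma full_orbit_swapped:
  assumes "full_orbit \<theta> p"
  shows "full_orbit (swapped \<theta>) (prod.swap p)"
proof -
  have "bij_betw (prod.swap \<circ> (\<lambda>x. (\<theta> ^^ x) p)) {..<6} UNIV"
    using assms unfolding full_orbit_def by (blast intro: bij_betw_trans bij_swap)
  then show ?thesis
    using assms by (simp add: full_orbit_def swapped_funpow comp_def)
qed

lemma orbit_swapped: "orbit (swapped \<theta>) (prod.swap p) = map prod.swap (orbit \<theta> p)"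
  by (simp add: orbit_def swapped_funpow)

text \<open>
  The counts of closed chains, with each grid point replaced by its position in the word of the
  cycle. The permutation then becomes the shift modulo 6.
\<close>

definition word_pairs :: "('a \<times> 'b) list \<Rightarrow> nat \<Rightarrow> nat \<Rightarrow> nat" where
  "word_pairs u k l = (\<Sum>x<6. \<Sum>y<6. of_bool (
     fst (u ! ((x + k) mod 6)) = fst (u ! x) \<and> fst (u ! ((y + l) mod 6)) = fst (u ! y) \<and>
     snd (u ! ((y + l) mod 6)) = snd (u ! x) \<and> snd (u ! y) = snd (u ! ((x + k) mod 6))))"

definition word_triples :: "('a \<times> 'b) list \<Rightarrow> nat \<Rightarrow> nat \<Rightarrow> nat \<Rightarrow> nat" where
  "word_triples u k l m = (\<Sum>x<6. \<Sum>y<6. \<Sum>z<6. of_bool (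
     fst (u ! ((x + k) mod 6)) = fst (u ! x) \<and> fst (u ! ((y + l) mod 6)) = fst (u ! y) \<and>
     fst (u ! ((z + m) mod 6)) = fst (u ! z) \<and>
     snd (u ! ((y + l) mod 6)) = snd (u ! x) \<and> snd (u ! ((z + m) mod 6)) = snd (u ! y) \<and>
     snd (u ! z) = snd (u ! ((x + k) mod 6))))"

lemma sum_orbit:
  assumes "full_orbit \<theta> p"
  shows "(\<Sum>q\<in>UNIV. f q) = (\<Sum>x<6. f ((\<theta> ^^ x) p))"
  using assms sum.reindex_bij_betw[of "\<lambda>x. (\<theta> ^^ x) p" "{..<6}" UNIV f]
  by (simp add: full_orbit_def)

lemma closed_pairs_orbit:
  assumes "full_orbit \<theta> p"
  shows "closed_pairs \<theta> k l = word_pairs (orbit \<theta> p) k l"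
  unfolding closed_pairs_def word_pairs_def sum_orbit[OF assms]
  by (intro sum.cong refl) (simp add: nth_orbit_add[OF assms] nth_orbit)

lemma closed_triples_orbit:
  assumes "full_orbit \<theta> p"
  shows "closed_triples \<theta> k l m = word_triples (orbit \<theta> p) k l m"
  unfolding closed_triples_def word_triples_def sum_orbit[OF assms]
  by (intro sum.cong refl) (simp add: nth_orbit_add[OF assms] nth_orbit)

text \<open>
  For a word of \<open>\<theta>\<close> these are the traces of \<open>X\<^sub>1X\<^sub>5\<close>, \<open>Y\<^sub>1Y\<^sub>5\<close> and \<open>Y\<^sub>1Y\<^sub>2Y\<^sub>5\<close>, where \<open>X\<^sub>k\<close> and
  \<open>Y\<^sub>k\<close> are the partial traces of \<open>\<pi>(\<theta>)\<^sup>k\<close> over the second and the first factor.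
\<close>

definition invariants :: "('a \<times> 'b) list \<Rightarrow> nat \<times> nat \<times> nat" where
  "invariants u =
     (word_pairs (map prod.swap u) 1 5, word_pairs u 1 5, word_triples u 1 2 5)"

lemma invariants_orbit_eq_if_equivalent:
  assumes "product_unitarily_equivalent \<theta> \<tau>" and "full_orbit \<theta> p" and "full_orbit \<tau> q"
  shows "invariants (orbit \<theta> p) = invariants (orbit \<tau> q)"
proof -
  have "word_pairs (orbit \<theta> p) k l = word_pairs (orbit \<tau> q) k l"
    and "word_triples (orbit \<theta> p) k l m = word_triples (orbit \<tau> q) k l m" for k l m
    using closed_counts_eq_if_equivalent[OF assms(1)]
    by (simp_all add: closed_pairs_orbit[OF assms(2)] closed_pairs_orbit[OF assms(3)]
        closed_triples_orbit[OF assms(2)] closed_triples_orbit[OF assms(3)])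
  moreover have "word_pairs (map prod.swap (orbit \<theta> p)) k l =
      word_pairs (map prod.swap (orbit \<tau> q)) k l" for k l
    using closed_counts_eq_if_equivalent(1)[OF product_unitarily_equivalent_swapped[OF assms(1)]]
    by (simp add: closed_pairs_orbit[OF full_orbit_swapped[OF assms(2)]]
        closed_pairs_orbit[OF full_orbit_swapped[OF assms(3)]] orbit_swapped)
  ultimately show ?thesis
    by (simp add: invariants_def)
qed

section \<open>Coincidence patterns\<close>

text \<open>
  Two words have the same pattern if one arises from the other by renaming rows and columns. It is
  phrased through \<open>zip\<close> in order to evaluate each word once when patterns are compared by
  rewriting.
\<close>

definition same_pattern :: "('a \<times> 'b) list \<Rightarrow> ('c \<times> 'd) list \<Rightarrow> bool" where
  "same_pattern u v \<longleftrightarrow> (\<forall>((i, j), (k, l)) \<in> set (zip u v). \<forall>((i', j'), (k', l')) \<in> set (zip u v).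
     (i = i' \<longleftrightarrow> k = k') \<and> (j = j' \<longleftrightarrow> l = l'))"

lemma same_pattern_iff_nth:
  assumes "length u = 6" and "length v = 6"
  shows "same_pattern u v \<longleftrightarrow> (\<forall>x<6. \<forall>y<6.
     (fst (u ! x) = fst (u ! y) \<longleftrightarrow> fst (v ! x) = fst (v ! y)) \<and>
     (snd (u ! x) = snd (u ! y) \<longleftrightarrow> snd (v ! x) = snd (v ! y)))"
  (is "_ \<longleftrightarrow> (\<forall>x<6. \<forall>y<6. ?P x y)")
proof -
  have "set (zip u v) = (\<lambda>x. (u ! x, v ! x)) ` {..<6}"
    using assms by (auto simp: set_zip)
  then show ?thesis
    by (auto simp: same_pattern_def case_prod_unfold)
qed

lemma invariants_eq_if_same_pattern:
  assumes "length u = 6" and "length v = 6" and "same_pattern u v"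
  shows "invariants u = invariants v"
proof -
  have fst: "fst (u ! x) = fst (u ! y) \<longleftrightarrow> fst (v ! x) = fst (v ! y)"
    and snd: "snd (u ! x) = snd (u ! y) \<longleftrightarrow> snd (v ! x) = snd (v ! y)" if "x < 6" "y < 6" for x y
    using assms that by (simp_all add: same_pattern_iff_nth)
  have "word_pairs u k l = word_pairs v k l" "word_triples u k l m = word_triples v k l m"
    "word_pairs (map prod.swap u) k l = word_pairs (map prod.swap v) k l" for k l m
    unfolding word_pairs_def word_triples_def
    by (intro sum.cong refl arg_cong[where f = of_bool] conj_cong; simp add: fst snd assms(1,2))+
  then show ?thesis
    by (simp add: invariants_def)
qed

lemma same_pattern_if_common:
  assumes "length u = 6" "length v = 6" "length w = 6"
    and "same_pattern u w" and "same_pattern v w"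
  shows "same_pattern u v"
  using assms by (simp add: same_pattern_iff_nth)

text \<open>
  Equal coincidences make \<open>g x \<mapsto> f x\<close> a well-defined injective map, hence a permutation when \<open>g\<close> is
  onto a finite type.
\<close>

lemma permutes_matching:
  fixes f g :: "nat \<Rightarrow> 'a::finite"
  assumes "g ` {..<n} = UNIV"
    and "\<And>x y. x < n \<Longrightarrow> y < n \<Longrightarrow> f x = f y \<longleftrightarrow> g x = g y"
  shows "\<exists>\<alpha>. \<alpha> permutes UNIV \<and> (\<forall>x<n. \<alpha> (g x) = f x)"
proof -
  define \<alpha> where "\<alpha> = f \<circ> inv_into {..<n} g"
  have preimage: "inv_into {..<n} g i < n" "g (inv_into {..<n} g i) = i" for i
    using inv_into_into[of i g "{..<n}"] f_inv_into_f[of i g "{..<n}"] assms(1) by auto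
  have "inj \<alpha>"
    by (rule injI) (metis \<alpha>_def assms(2) comp_apply preimage)
  then have "bij \<alpha>"
    by (simp add: bij_def finite_UNIV_inj_surj)
  moreover have "\<alpha> (g x) = f x" if "x < n" for x
    using that preimage assms(2) by (simp add: \<alpha>_def)
  ultimately show ?thesis
    by (auto intro!: bij_imp_permutes)
qed

text \<open>
  The renaming of rows and columns that takes one word to the other is the conjugating
  permutation, because along the words \<open>\<theta>\<close> and \<open>\<tau>\<close> are both the shift.
\<close>

lemma product_conjugate_if_same_pattern:
  fixes \<theta> \<tau> :: "'m::finite \<times> 'n::finite \<Rightarrow> 'm \<times> 'n"
  assumes "full_orbit \<theta> p" and "full_orbit \<tau> q" and "same_pattern (orbit \<theta> p) (orbit \<tau> q)"
  shows "product_conjugate \<theta> \<tau>"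
proof -
  let ?f = "\<lambda>x. (\<theta> ^^ x) p" and ?g = "\<lambda>x. (\<tau> ^^ x) q"
  have surj: "?g ` {..<6} = UNIV"
    using assms(2) by (simp add: full_orbit_def bij_betw_def)
  have "fst ` ?g ` {..<6} = UNIV" "snd ` ?g ` {..<6} = UNIV"
    unfolding surj by simp_all
  then have images: "(\<lambda>x. fst (?g x)) ` {..<6} = UNIV" "(\<lambda>x. snd (?g x)) ` {..<6} = UNIV"
    by (simp_all add: image_image)
  obtain \<alpha> where \<alpha>: "\<alpha> permutes UNIV" "\<And>x. x < 6 \<Longrightarrow> \<alpha> (fst (?g x)) = fst (?f x)"
    using permutes_matching[OF images(1), of "\<lambda>x. fst (?f x)"] assms(3)
    by (auto simp: same_pattern_iff_nth nth_orbit)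
  obtain \<beta> where \<beta>: "\<beta> permutes UNIV" "\<And>x. x < 6 \<Longrightarrow> \<beta> (snd (?g x)) = snd (?f x)"
    using permutes_matching[OF images(2), of "\<lambda>x. snd (?f x)"] assms(3)
    by (auto simp: same_pattern_iff_nth nth_orbit)
  define \<sigma> where "\<sigma> = map_prod \<alpha> \<beta>"
  have "bij \<sigma>"
    unfolding \<sigma>_def using \<alpha>(1) \<beta>(1)
    by (metis UNIV_Times_UNIV bij_betw_map_prod permutes_imp_bij)
  have small: "\<sigma> (?g x) = ?f x" if "x < 6" for x
    using that by (simp add: \<sigma>_def prod_eq_iff \<alpha>(2) \<beta>(2))
  have matches: "\<sigma> (?g x) = ?f x" for x
    using small[of "x mod 6"] assms(1,2) by (simp add: full_orbit_def funpow_mod_eq)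
  have "\<theta> (\<sigma> u) = \<sigma> (\<tau> u)" for u
  proof -
    obtain x where "u = ?g x" using surj by (metis UNIV_I imageE)
    then show ?thesis using matches[of x] matches[of "Suc x"] by simp
  qed
  then have "\<theta> \<circ> \<sigma> = \<sigma> \<circ> \<tau>"
    by (simp add: fun_eq_iff)
  then have "\<theta> = \<sigma> \<circ> \<tau> \<circ> inv \<sigma>"
    using \<open>bij \<sigma>\<close> by (metis bij_is_surj comp_assoc comp_id surj_iff)
  then show ?thesis
    using \<alpha>(1) \<beta>(1) unfolding product_conjugate_def \<sigma>_def by blast
qed

section \<open>The fourteen classes\<close>

text \<open>
  One word from each class, over the grid \<open>{0,1} \<times> {0,1,2}\<close> of natural numbers, on which
  computation by rewriting is easy. Each begins at the corner.
\<close>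

definition representatives :: "(nat \<times> nat) list list" where
  "representatives = [
     [(0,0),(0,1),(0,2),(1,0),(1,1),(1,2)],
     [(0,0),(0,1),(0,2),(1,0),(1,2),(1,1)],
     [(0,0),(0,1),(0,2),(1,1),(1,2),(1,0)],
     [(0,0),(0,1),(0,2),(1,1),(1,0),(1,2)],
     [(0,0),(0,1),(0,2),(1,2),(1,1),(1,0)],
     [(0,0),(0,1),(1,0),(0,2),(1,1),(1,2)],
     [(0,0),(0,1),(1,0),(1,2),(0,2),(1,1)],
     [(0,0),(0,1),(1,0),(0,2),(1,2),(1,1)],
     [(0,0),(0,1),(1,0),(1,1),(0,2),(1,2)],
     [(0,0),(0,1),(1,1),(1,2),(0,2),(1,0)],
     [(0,0),(0,1),(1,1),(1,0),(0,2),(1,2)],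
     [(0,0),(1,0),(0,1),(1,1),(0,2),(1,2)],
     [(0,0),(1,0),(0,1),(1,2),(0,2),(1,1)],
     [(0,0),(1,1),(0,2),(1,0),(0,1),(1,2)]]"

text \<open>
  The first two entries leave two ties, at \<open>(0,4)\<close> and at \<open>(1,2)\<close>; the cubic trace breaks both.
\<close>

lemma invariants_representatives:
  "map invariants representatives =
     [(0,8,0), (0,4,2), (1,6,0), (0,4,0), (2,4,2), (0,2,0), (1,2,0),
      (1,2,1), (1,4,0), (5,2,0), (4,2,0), (9,0,0), (2,0,0), (0,0,0)]"
  by code_simp

lemma inj_on_invariants_representatives: "inj_on invariants (set representatives)"
proof -
  have "distinct (map invariants representatives)"
    unfolding invariants_representatives by simp
  then show ?thesis by (simp only: distinct_map)
qed

lemma length_representatives: "v \<in> set representatives \<Longrightarrow> length v = 6"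
  by (auto simp: representatives_def)

text \<open>
  Every cycle has a word that starts at the corner, which leaves 120 words. Such a word need not
  have the pattern of a representative, but one of its rotations does.
\<close>

lemma representatives_exhaust:
  "\<forall>u \<in> permutations_of_set (set [(0,1), (0,2), (1,0), (1,1), (1,2) :: nat \<times> nat]).
     \<exists>k \<in> set [0..<6]. let w = rotate k ((0,0) # u) in \<exists>v \<in> set representatives. same_pattern w v"
  by code_simp

lemma same_pattern_map_inj:
  assumes "inj f" and "inj g" and "length u = 6" and "length v = 6"
  shows "same_pattern (map (map_prod f g) u) v \<longleftrightarrow> same_pattern u v"
  using assms by (simp add: same_pattern_iff_nth inj_eq)

text \<open>
  The grid is numbered from 0, with \<open>(1, 1)\<close> at the corner. The rotation that brings the word from
  there into the pattern of a representative amounts to another choice of starting point.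
\<close>

lemma ex_representative:
  fixes \<theta> :: "2 \<times> 3 \<Rightarrow> 2 \<times> 3"
  assumes full: "\<And>p. full_orbit \<theta> p"
  shows "\<exists>p. \<exists>v \<in> set representatives. same_pattern (orbit \<theta> p) v"
proof -
  define f :: "2 \<Rightarrow> nat" where "f i = (if i = 1 then 0 else 1)" for i
  define g :: "3 \<Rightarrow> nat" where "g j = (if j = 1 then 0 else if j = 2 then 1 else 2)" for j
  define h where "h = map_prod f g"
  have f: "inj f" "range f = {0, 1}"
    unfolding inj_def f_def UNIV_2 by (auto simp: forall_2)
  have g: "inj g" "range g = {0, 1, 2}"
    unfolding inj_def g_def UNIV_3 by (auto simp: forall_3)
  have h: "inj h" "range h = {0, 1} \<times> {0, 1, 2}" "h (1, 1) = (0, 0)"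
    unfolding h_def
    using prod.inj_map[OF f(1) g(1)] map_prod_surj_on[OF f(2) g(2)]
    by (simp_all add: f_def g_def)
  define u where "u = tl (map h (orbit \<theta> (1, 1)))"
  have u: "map h (orbit \<theta> (1, 1)) = (0, 0) # u"
    by (simp add: u_def orbit_def upt_rec[of 0] h(3))
  have "distinct ((0, 0) # u)" "set ((0, 0) # u) = {0, 1} \<times> {0, 1, 2}"
    unfolding u[symmetric] using distinct_orbit[OF full] set_orbit[OF full] h(1,2)
    by (simp_all add: distinct_map inj_on_subset)
  then have "distinct u" "set u = {0, 1} \<times> {0, 1, 2} - {(0, 0)}"
    by (simp, metis Diff_insert_absorb distinct.simps(2) list.simps(15))
  then have "u \<in> permutations_of_set (set [(0,1), (0,2), (1,0), (1,1), (1,2)])"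
    by (intro permutations_of_setI) auto
  then obtain k v where v: "v \<in> set representatives"
      and pattern: "same_pattern (rotate k ((0, 0) # u)) v"
    using representatives_exhaust unfolding Let_def by blast
  have "rotate k ((0, 0) # u) = map h (orbit \<theta> ((\<theta> ^^ k) (1, 1)))"
    by (simp add: rotate_orbit[OF full] rotate_map flip: u)
  then have "same_pattern (orbit \<theta> ((\<theta> ^^ k) (1, 1))) v"
    using pattern
    by (simp add: h_def same_pattern_map_inj[OF f(1) g(1) length_orbit length_representatives[OF v]])
  then show ?thesis
    using v by blast
qed

theorem proposition4p3:
  fixes \<theta> \<tau> :: "2 \<times> 3 \<Rightarrow> 2 \<times> 3"
  assumes "is_cycle_of_length 6 \<theta>" and "is_cycle_of_length 6 \<tau>"
    and "\<not> product_conjugate \<theta> \<tau>"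
  shows "\<not> product_unitarily_equivalent \<theta> \<tau>"
proof
  assume equivalent: "product_unitarily_equivalent \<theta> \<tau>"
  have full: "full_orbit \<theta> p" "full_orbit \<tau> p" for p
    using assms(1,2) by (simp_all add: full_orbit_cycle)
  obtain p v where v: "v \<in> set representatives" "same_pattern (orbit \<theta> p) v"
    using ex_representative full(1) by blast
  obtain q w where w: "w \<in> set representatives" "same_pattern (orbit \<tau> q) w"
    using ex_representative full(2) by blast
  have "invariants v = invariants (orbit \<theta> p)"
    using v by (intro invariants_eq_if_same_pattern[symmetric]) (simp_all add: length_representatives)
  also have "\<dots> = invariants (orbit \<tau> q)"
    using equivalent full by (rule invariants_orbit_eq_if_equivalent)
  also have "\<dots> = invariants w"
    using w by (intro invariants_eq_if_same_pattern) (simp_all add: length_representatives)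
  finally have "v = w"
    using inj_on_invariants_representatives v(1) w(1) by (simp add: inj_on_eq_iff)
  have "same_pattern (orbit \<theta> p) (orbit \<tau> q)"
    by (rule same_pattern_if_common[OF length_orbit length_orbit length_representatives[OF v(1)] v(2)])
      (simp add: \<open>v = w\<close> w(2))
  then have "product_conjugate \<theta> \<tau>"
    by (rule product_conjugate_if_same_pattern[OF full])
  with assms(3) show False ..
qed

end
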